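(* For any real constants $a, b > 0$, as $n \to \infty$ through the positive integers, $$\lambda(\lfloor an \rfloor, \lfloor bn \rfloor) \;\sim\; \frac{a b^2}{2}\, n^3.$$
   Context: A Davenport--Schinzel sequence of order $s$ over an $m$-letter alphabet is a finite sequence of letters from an alphabet of size $m$ (not every letter has to occur) with no immediate repetitions (no two adjacent terms are equal) and with no alternating subsequence of length $s+2$, i.e. no (not necessarily contiguous) subsequence of the form $a', b', a', b', \ldots$ of length $s+2$ with letters $a' \neq b'$. For positive integers $s, m$, $\lambda(s,m)$ denotes the maximum length of a Davenport--Schinzel sequence of order $s$ over an $m$-letter alphabet. The notation $f(n) \sim g(n)$ means $f(n)/g(n) \to 1$ as $n \to \infty$ (only $n$ large enough that $\lfloor an\rfloor, \lfloor bn \rfloor \geq 1$ are considered). *)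

theory Defs
  imports Complex_Main "HOL-Library.Sublist" "HOL-Library.Landau_Symbols"
begin

definition alternation :: "'a \<Rightarrow> 'a \<Rightarrow> nat \<Rightarrow> 'a list" where
  "alternation x y k = map (\<lambda>i. if even i then x else y) [0..<k]"

text \<open>\<^const>\<open>subseq\<close> is the not necessarily contiguous subsequence relation.\<close>

definition davenport_schinzel :: "nat \<Rightarrow> 'a set \<Rightarrow> 'a list \<Rightarrow> bool" where
  "davenport_schinzel s A xs \<longleftrightarrow>
     set xs \<subseteq> A \<and> distinct_adj xs \<and>
     \<not> (\<exists>x y. x \<noteq> y \<and> subseq (alternation x y (s + 2)) xs)"

text \<open>
  The set of lengths contains \<open>0\<close> and is finite, so \<^const>\<open>Max\<close> is the genuine maximum: in
  the restriction of such a sequence to two letters the letter changes at most \<open>s\<close> times, and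
  every pair of adjacent terms is a change for exactly one pair of letters, so the length is at
  most \<open>s * (m choose 2) + 1\<close>.
\<close>

definition ds_lambda :: "nat \<Rightarrow> nat \<Rightarrow> nat" where
  "ds_lambda s m = Max {length xs | xs. davenport_schinzel s {..<m} xs}"

end

theory Submission
  imports Defs "HOL-Real_Asymp.Real_Asymp" "HOL-Number_Theory.Cong"
begin

text \<open>
  The upper bound is a count of changes of letter. In a word with no immediate repetitions every
  pair of adjacent terms is a change for exactly one two-element set of letters, and a sequence of
  order \<open>s\<close> allows each such set at most \<open>s\<close> changes. Hence
  \<open>\<lambda>(s, m) \<le> 1 + (m choose 2) * s\<close>, which is asymptotically \<open>s * m\<^sup>2 / 2\<close>.

  For the lower bound nearly every change allowed to a pair must be realised by adjacent terms.
  The word \<open>x y x y \<dots>\<close> of length close to \<open>s\<close> does this for the single pair \<open>{x, y}\<close>, so it is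
  tempting to concatenate such words over all pairs. The trouble is interference: the words for the
  pairs \<open>{x, z}\<close> and \<open>{y, z}\<close> with \<open>z\<close> outside \<open>{x, y}\<close> can produce further runs in the restriction
  to \<open>{x, y}\<close>, of the order of \<open>m\<close> many, and \<open>m\<close> is here of the same order as \<open>s\<close>. The remedy is
  to group the pairs into blocks of a fixed size \<open>k\<close> so that each pair lies in at most one block and
  each letter in at most about \<open>m / k\<close> blocks. If all words of the pairs within a block are placed
  next to each other, a block that contains only one of \<open>x\<close> and \<open>y\<close> contributes a single run to the
  restriction. So the loss is at most about \<open>2 * m / k\<close> outside the common block and at most
  \<open>k choose 2\<close> inside it, in whatever order blocks and pairs are arranged (\<open>packing_word\<close>).

  The blocks are the lines of a transversal design. The letters form \<open>k\<close> columns of \<open>N\<close> letters,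
  where \<open>k * N\<close> is at most \<open>m\<close>, and for residues \<open>u\<close> and \<open>v\<close> there is the line with
  the entry \<open>u + i * v\<close> modulo \<open>N\<close> in column \<open>i\<close>. Two lines share at most one letter if all
  differences of distinct columns are invertible modulo \<open>N\<close>, and for this it is enough that
  \<open>N\<close> is coprime to \<open>fact k\<close>. As \<open>k\<close> is fixed, such an \<open>N\<close> exists within a bounded distance
  of \<open>m / k\<close>: the numbers congruent to \<open>1\<close> modulo \<open>fact k\<close> are coprime to it. The \<open>N\<^sup>2\<close> lines, each with
  \<open>k choose 2\<close> pairs and about \<open>s - 2 * N\<close> terms for each of them, give
  (\<open>ds_lambda_ge\<close>) asymptotically \<open>(1 - 1 / k) * (s - 2 * m / k) * m\<^sup>2 / 2\<close> terms. Since \<open>s\<close> and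
  \<open>m\<close> grow proportionally, this is within any given factor below \<open>1\<close> of the upper bound as
  soon as \<open>k\<close> is large enough.
\<close>

section \<open>Runs of a word over a set of letters\<close>

text \<open>
  For \<open>K = {x, y}\<close> this is the length of a longest alternating subsequence in \<open>x\<close> and \<open>y\<close>
  (\<open>subseq_alternation_iff\<close>). Counting runs instead of alternations makes the
  quantity subadditive under concatenation.
\<close>
definition runs :: "'a set \<Rightarrow> 'a list \<Rightarrow> nat" where
  "runs K xs = length (remdups_adj (filter (\<lambda>x. x \<in> K) xs))"

lemma runs_Nil [simp]: "runs K [] = 0"
  by (simp add: runs_def)

lemma runs_le_length: "runs K xs \<le> length xs"
  unfolding runs_def by (meson length_filter_le order_trans remdups_adj_length)

lemma runs_le_runs_Cons:
  "runs K xs \<le> runs K (x # xs)"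
  by (simp add: runs_def remdups_adj_Cons split: list.split)

lemma runs_append: "runs K (xs @ ys) \<le> runs K xs + runs K ys"
proof (induction xs)
  case (Cons x xs)
  have step: "runs K (x # zs) = runs K zs + of_bool (x \<in> K \<and>
      (filter (\<lambda>x. x \<in> K) zs = [] \<or> hd (filter (\<lambda>x. x \<in> K) zs) \<noteq> x))" for zs
    by (cases "filter (\<lambda>x. x \<in> K) zs") (auto simp: runs_def)
  show ?case
  proof (cases "filter (\<lambda>x. x \<in> K) xs")
    case Nil
    then show ?thesis using Cons.IH by (auto simp: step)
  next
    case (Cons z zs)
    then show ?thesis using Cons.IH by (auto simp: step)
  qed
qed simp

text \<open>
  This covers the words that meet \<open>K\<close> in no letter or in a single one. They cannot alternate,
  however long they are, and this is why a block costs a letter only one run.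
\<close>
lemma runs_le_card:
  assumes "card (set xs \<inter> K) \<le> 1"
  shows "runs K xs \<le> card (set xs \<inter> K)"
proof (cases "set xs \<inter> K = {}")
  case True
  then have "filter (\<lambda>x. x \<in> K) xs = []" by (auto simp: filter_empty_conv)
  then show ?thesis by (simp add: runs_def)
next
  case False
  then have "card (set xs \<inter> K) = 1"
    using assms by (metis List.finite_set One_nat_def card_0_eq finite_Int le_Suc_eq le_zero_eq)
  then obtain x where "set xs \<inter> K = {x}" by (metis card_1_singletonE)
  then have "set (filter (\<lambda>x. x \<in> K) xs) \<subseteq> {x}" by auto
  then have "filter (\<lambda>x. x \<in> K) xs = replicate (length (filter (\<lambda>x. x \<in> K) xs)) x"
    by (intro replicate_eqI) auto
  then have "runs K xs \<le> 1"
    unfolding runs_def by (metis One_nat_def le_0_eq list.size(3) list.size(4) nat_le_linear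
        remdups_adj_replicate add_0 Suc_eq_plus1)
  then show ?thesis using \<open>card (set xs \<inter> K) = 1\<close> by simp
qed

lemma alternation_0 [simp]: "alternation x y 0 = []"
  by (simp add: alternation_def)

lemma alternation_Suc: "alternation x y (Suc k) = x # alternation y x k"
proof -
  have "[0..<Suc k] = 0 # map Suc [0..<k]" by (simp add: upt_conv_Cons map_Suc_upt)
  then show ?thesis by (simp add: alternation_def)
qed

lemma length_alternation [simp]: "length (alternation x y k) = k"
  by (simp add: alternation_def)

lemma set_alternation: "set (alternation x y k) \<subseteq> {x, y}"
  by (auto simp: alternation_def)

lemma take_alternation: "j \<le> k \<Longrightarrow> take j (alternation x y k) = alternation x y j"
  by (simp add: alternation_def take_map)

lemma distinct_adj_alternation:
  assumes "x \<noteq> y" shows "distinct_adj (alternation x y k)"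
  using assms
proof (induction k arbitrary: x y)
  case (Suc k)
  then show ?case by (cases k) (auto simp: alternation_Suc)
qed simp

lemma distinct_adj_two_letters:
  assumes "x \<noteq> y" "distinct_adj (x # zs)" "set zs \<subseteq> {x, y}"
  shows "x # zs = alternation x y (Suc (length zs))"
  using assms
proof (induction zs arbitrary: x y)
  case (Cons z zs)
  then have "z = y" by auto
  then show ?case using Cons.IH[of y x] Cons.prems by (auto simp: alternation_Suc)
qed (simp add: alternation_Suc)

lemma subseq_remdups_adj: "subseq (remdups_adj xs) xs"
  by (induction xs rule: remdups_adj.induct) auto

text \<open>
  A subsequence without immediate repetitions uses at most one term of each run, so it survives
  the collapse of every run to a single term.
\<close>
lemma subseq_distinct_adj:
  assumes "subseq ys xs" "distinct_adj ys"
  shows "subseq ys (remdups_adj xs)"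
  using assms
proof (induction xs arbitrary: ys rule: remdups_adj.induct)
  case (3 x z xs)
  show ?case
  proof (cases ys)
    case (Cons y ys')
    show ?thesis
    proof (cases "x = z")
      case True
      have "subseq ys (x # xs)"
      proof (cases "y = x")
        case True
        with Cons 3 \<open>x = z\<close> have "subseq ys' (x # xs)" by simp
        then have "subseq ys' xs"
          using Cons 3 True by (cases ys') auto
        then show ?thesis using Cons True by simp
      next
        case False
        then show ?thesis using Cons 3 \<open>x = z\<close> by auto
      qed
      then show ?thesis using 3 True by simp
    next
      case False
      have IH: "subseq us (remdups_adj (z # xs))" if "subseq us (z # xs)" "distinct_adj us" for us
        using "3.IH"(2)[OF False that] .
      show ?thesis
      proof (cases "y = x")
        case True
        have "subseq ys' (z # xs)" "distinct_adj ys'"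
          using "3.prems" Cons True by (auto dest: distinct_adj_ConsD)
        from IH[OF this] show ?thesis using Cons True False by simp
      next
        case y: False
        then have "subseq ys (z # xs)" using "3.prems"(1) Cons by simp
        from list_emb_Cons[OF IH[OF this "3.prems"(2)]] show ?thesis using False by simp
      qed
    qed
  qed simp
qed (auto)

lemma subseq_alternation_iff:
  assumes "x \<noteq> y"
  shows "k \<le> runs {x, y} xs \<longleftrightarrow>
    subseq (alternation x y k) xs \<or> subseq (alternation y x k) xs"
    (is "_ \<longleftrightarrow> ?R")
proof
  assume k: "k \<le> runs {x, y} xs"
  define zs where "zs = remdups_adj (filter (\<lambda>z. z \<in> {x, y}) xs)"
  have zs: "distinct_adj zs" "set zs \<subseteq> {x, y}" "subseq zs xs" "k \<le> length zs"
    using k subseq_order.trans[OF subseq_remdups_adj subseq_filter_left]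
    by (auto simp: zs_def runs_def)
  have "zs = alternation x y (length zs) \<or> zs = alternation y x (length zs)"
  proof (cases zs)
    case (Cons w ws)
    with zs have "w = x \<or> w = y" by auto
    with Cons zs distinct_adj_two_letters[OF assms, of ws]
      distinct_adj_two_letters[OF assms[symmetric], of ws] show ?thesis by auto
  qed simp
  then have "take k zs = alternation x y k \<or> take k zs = alternation y x k"
    using take_alternation[OF zs(4)] by metis
  moreover have "subseq (take k zs) xs"
    using zs(3) by (metis append_take_drop_id subseq_order.refl
        subseq_order.order_trans subseq_rev_drop_many)
  ultimately show ?R by auto
next
  have *: "k \<le> runs {u, v} xs" if "u \<noteq> v" "subseq (alternation u v k) xs" for u v
  proof -
    have "filter (\<lambda>z. z \<in> {u, v}) (alternation u v k) = alternation u v k"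
      using set_alternation[of u v k] by (intro filter_True) auto
    then have "subseq (alternation u v k) (filter (\<lambda>z. z \<in> {u, v}) xs)"
      using subseq_filter[OF that(2), of "\<lambda>z. z \<in> {u, v}"] by simp
    from list_emb_length[OF subseq_distinct_adj[OF this distinct_adj_alternation[OF that(1)]]]
    show ?thesis by (simp add: runs_def)
  qed
  assume ?R
  then show "k \<le> runs {x, y} xs"
    using *[of x y] *[of y x] assms by (auto simp: insert_commute)
qed

text \<open>
  The bound is \<open>s + 1\<close> since \<open>s\<close> changes of letter separate \<open>s + 1\<close> runs.
\<close>
lemma davenport_schinzel_iff_runs:
  "davenport_schinzel s A xs \<longleftrightarrow>
     set xs \<subseteq> A \<and> distinct_adj xs \<and> (\<forall>K. card K = 2 \<longrightarrow> runs K xs \<le> s + 1)"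
proof -
  have "(\<exists>x y. x \<noteq> y \<and> subseq (alternation x y (s + 2)) xs) \<longleftrightarrow>
        (\<exists>K. card K = 2 \<and> s + 2 \<le> runs K xs)" (is "?L \<longleftrightarrow> ?R")
  proof
    assume ?L
    then obtain x y where xy: "x \<noteq> y" "subseq (alternation x y (s + 2)) xs" by blast
    then have "s + 2 \<le> runs {x, y} xs" using subseq_alternation_iff[OF xy(1)] by blast
    with xy(1) show ?R by (intro exI[of _ "{x, y}"]) simp
  next
    assume ?R
    then obtain x y where xy: "x \<noteq> y" "s + 2 \<le> runs {x, y} xs" by (auto simp: card_2_iff)
    then consider "subseq (alternation x y (s + 2)) xs" | "subseq (alternation y x (s + 2)) xs"
      unfolding subseq_alternation_iff[OF xy(1)] by (elim disjE)
    then show ?L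
    proof cases
      case 1
      with xy(1) show ?thesis by (intro exI[of _ x] exI[of _ y] conjI)
    next
      case 2
      with xy(1)[symmetric] show ?thesis by (intro exI[of _ y] exI[of _ x] conjI)
    qed
  qed
  also have "\<dots> \<longleftrightarrow> \<not> (\<forall>K. card K = 2 \<longrightarrow> runs K xs \<le> s + 1)"
    by (simp add: not_le Suc_le_eq)
  finally show ?thesis unfolding davenport_schinzel_def by simp
qed

section \<open>The upper bound\<close>

text \<open>
  A letter put in front of a word that starts with a different letter adds a run for the pair of
  these two letters and removes no run of any other pair. The difference \<open>runs K xs - 1\<close> is the
  number of changes; truncation makes it \<open>0\<close> when no letter of \<open>K\<close> occurs.
\<close>
lemma length_le_sum_runs:
  assumes "finite A" "set xs \<subseteq> A" "distinct_adj xs"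
  shows "length xs \<le> 1 + (\<Sum>K | K \<subseteq> A \<and> card K = 2. runs K xs - 1)"
  using assms(2,3)
proof (induction xs)
  case (Cons x xs)
  let ?P = "{K. K \<subseteq> A \<and> card K = 2}"
  show ?case
  proof (cases xs)
    case (Cons y ys)
    with Cons.prems have xy: "x \<noteq> y" "{x, y} \<in> ?P" by auto
    have "length xs \<le> 1 + (\<Sum>K\<in>?P. runs K xs - 1)"
      using Cons.IH Cons.prems by (auto dest: distinct_adj_ConsD)
    also have "(\<Sum>K\<in>?P. runs K xs - 1) < (\<Sum>K\<in>?P. runs K (x # xs) - 1)"
    proof (rule sum_strict_mono_ex1)
      show "finite ?P" using assms(1) by simp
      show "\<forall>K\<in>?P. runs K xs - 1 \<le> runs K (x # xs) - 1"
        by (intro ballI diff_le_mono runs_le_runs_Cons)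
      have "runs {x, y} (x # xs) = Suc (runs {x, y} xs)" "runs {x, y} xs > 0"
        using xy Cons by (auto simp: runs_def)
      then have "runs {x, y} xs - 1 < runs {x, y} (x # xs) - 1" by simp
      then show "\<exists>K\<in>?P. runs K xs - 1 < runs K (x # xs) - 1" using xy by blast
    qed
    finally show ?thesis by simp
  qed simp
qed simp

lemma davenport_schinzel_length_le:
  assumes "davenport_schinzel s A xs" "finite A"
  shows "length xs \<le> 1 + (card A choose 2) * s"
proof -
  have "length xs \<le> 1 + (\<Sum>K | K \<subseteq> A \<and> card K = 2. runs K xs - 1)"
    using assms by (intro length_le_sum_runs) (auto simp: davenport_schinzel_iff_runs)
  also have "\<dots> \<le> 1 + (\<Sum>K | K \<subseteq> A \<and> card K = 2. s)"
    using davenport_schinzel_iff_runs[of s A xs] assms(1)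
    by (intro add_left_mono sum_mono) (auto simp: le_diff_conv)
  also have "\<dots> = 1 + (card A choose 2) * s"
    using n_subsets[OF assms(2), of 2] by simp
  finally show ?thesis .
qed

lemma finite_davenport_schinzel_lengths:
  "finite {length xs | xs. davenport_schinzel s {..<m::nat} xs}"
proof (rule finite_subset)
  show "{length xs | xs. davenport_schinzel s {..<m} xs} \<subseteq> {..1 + (m choose 2) * s}"
    using davenport_schinzel_length_le[of s "{..<m}"] by auto
qed simp

lemma length_le_ds_lambda: "davenport_schinzel s {..<m} xs \<Longrightarrow> length xs \<le> ds_lambda s m"
  unfolding ds_lambda_def by (rule Max_ge[OF finite_davenport_schinzel_lengths]) auto

text \<open>
  The empty word shows that the maximum is taken over a nonempty set.
\<close>
lemma ds_lambda_le: "ds_lambda s m \<le> 1 + (m choose 2) * s"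
proof -
  have "davenport_schinzel s {..<m} []"
    by (simp add: davenport_schinzel_iff_runs)
  then show ?thesis
    unfolding ds_lambda_def
    by (subst Max_le_iff[OF finite_davenport_schinzel_lengths])
      (use davenport_schinzel_length_le[of s "{..<m}"] in auto)
qed

section \<open>Words from block designs\<close>

text \<open>
  Concatenation in an arbitrary order, where a term is dropped at each junction that would repeat a
  letter. The order does not matter since only the subadditivity of \<^const>\<open>runs\<close> is used.
\<close>
lemma glue_words:
  assumes "finite I" "\<And>i. i \<in> I \<Longrightarrow> distinct_adj (w i)"
  shows "\<exists>xs. distinct_adj xs \<and> set xs = (\<Union>i\<in>I. set (w i)) \<and>
    (\<Sum>i\<in>I. length (w i)) \<le> length xs + card I \<and> (\<forall>K. runs K xs \<le> (\<Sum>i\<in>I. runs K (w i)))"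
  using assms
proof (induction I rule: finite_induct)
  case (insert i I)
  then obtain xs where xs: "distinct_adj xs" "set xs = (\<Union>i\<in>I. set (w i))"
    "(\<Sum>i\<in>I. length (w i)) \<le> length xs + card I" "\<forall>K. runs K xs \<le> (\<Sum>i\<in>I. runs K (w i))"
    by auto
  have w: "distinct_adj (w i)" using insert by auto
  show ?case
  proof (cases "w i = [] \<or> xs = [] \<or> last (w i) \<noteq> hd xs")
    case True
    have "runs K (w i @ xs) \<le> (\<Sum>i\<in>insert i I. runs K (w i))" for K
      using runs_append[of K "w i" xs] xs(4) insert.hyps by (simp add: le_trans)
    then show ?thesis
      using insert.hyps xs w True
      by (intro exI[of _ "w i @ xs"]) (auto simp: distinct_adj_append_iff)
  next
    case False
    then obtain x ys where ys: "xs = x # ys" "last (w i) = x" "x \<in> set (w i)"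
      using last_in_set[of "w i"] by (cases xs) auto
    have "runs K (w i @ ys) \<le> (\<Sum>i\<in>insert i I. runs K (w i))" for K
    proof -
      have "runs K (w i @ ys) \<le> runs K (w i) + runs K xs"
        using runs_append[of K "w i" ys] runs_le_runs_Cons[of K ys x] ys by simp
      also have "\<dots> \<le> runs K (w i) + (\<Sum>i\<in>I. runs K (w i))" using xs by simp
      finally show ?thesis using insert.hyps by simp
    qed
    moreover have "distinct_adj (w i @ ys)"
      using xs w ys by (cases ys) (auto simp: distinct_adj_append_iff)
    moreover have "set (w i @ ys) = (\<Union>i\<in>insert i I. set (w i))"
    proof -
      have "set (w i @ ys) = set (w i) \<union> set xs" using ys(1,3) by auto
      then show ?thesis using xs(2) by simp
    qed
    ultimately show ?thesis
      using insert.hyps xs ys by (intro exI[of _ "w i @ ys"]) auto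
  qed
qed simp

lemma card_2_Int_le_1:
  assumes "card E = 2" "card K = 2" "E \<noteq> K"
  shows "card (E \<inter> K) \<le> 1"
proof -
  have f: "finite E" "finite K" using assms by (auto intro: card_ge_0_finite)
  have "E \<inter> K \<subset> K" using assms f by (metis Int_lower1 Int_lower2 card_subset_eq psubsetI)
  then have "card (E \<inter> K) < card K" using f by (intro psubset_card_mono)
  then show ?thesis using assms by simp
qed

text \<open>
  Inside a block every pair receives an alternation of length \<open>t\<close>. In the restriction to \<open>K\<close>, the
  alternation of \<open>K\<close> itself accounts for up to \<open>t\<close> runs, and each of the other pairs, which has at
  most one letter in \<open>K\<close>, for at most one. The junctions cost at most one term per pair.
\<close>
lemma block_word:
  assumes "finite B"
  shows "\<exists>xs. distinct_adj xs \<and> set xs \<subseteq> B \<and>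
    (card B choose 2) * t \<le> length xs + (card B choose 2) \<and>
    (\<forall>K. card K = 2 \<longrightarrow> runs K xs \<le> t + (card B choose 2))"
proof -
  let ?P = "{E. E \<subseteq> B \<and> card E = 2}"
  have P: "finite ?P" "card ?P = card B choose 2"
    using assms n_subsets[OF assms, of 2] by auto
  have "\<exists>w. distinct_adj w \<and> set w \<subseteq> E \<and> length w = t" if "E \<in> ?P" for E
  proof -
    from that obtain x y where "E = {x, y}" "x \<noteq> y" by (auto simp: card_2_iff)
    then show ?thesis
      using distinct_adj_alternation[of x y t] set_alternation[of x y t]
      by (intro exI[of _ "alternation x y t"]) auto
  qed
  then have "\<exists>w. \<forall>E\<in>?P. distinct_adj (w E) \<and> set (w E) \<subseteq> E \<and> length (w E) = t"
    by (intro bchoice ballI)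
  then obtain w where "\<forall>E\<in>?P. distinct_adj (w E) \<and> set (w E) \<subseteq> E \<and> length (w E) = t"
    by (rule exE)
  then have w: "\<And>E. E \<in> ?P \<Longrightarrow> distinct_adj (w E)"
    "\<And>E. E \<in> ?P \<Longrightarrow> set (w E) \<subseteq> E" "\<And>E. E \<in> ?P \<Longrightarrow> length (w E) = t"
    by simp_all
  obtain xs where xs: "distinct_adj xs" "set xs = (\<Union>E\<in>?P. set (w E))"
    "(\<Sum>E\<in>?P. length (w E)) \<le> length xs + card ?P" "\<forall>K. runs K xs \<le> (\<Sum>E\<in>?P. runs K (w E))"
    using glue_words[of ?P w, OF P(1) w(1)] by blast
  have "runs K xs \<le> t + (card B choose 2)" if K: "card K = 2" for K
  proof -
    have *: "runs K (w E) \<le> (if E = K then t else 0) + 1" if E: "E \<in> ?P" for E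
    proof (cases "E = K")
      case True
      then show ?thesis using runs_le_length[of K "w E"] w(3)[OF E] by simp
    next
      case False
      have "card (set (w E) \<inter> K) \<le> card (E \<inter> K)"
        using w(2)[OF E] E assms by (intro card_mono) (auto intro: finite_subset)
      also have "\<dots> \<le> 1" using card_2_Int_le_1 E K False by auto
      finally show ?thesis using runs_le_card[of "w E" K] by simp
    qed
    have "runs K xs \<le> (\<Sum>E\<in>?P. runs K (w E))" using xs by simp
    also have "\<dots> \<le> (\<Sum>E\<in>?P. (if E = K then t else 0) + 1)" by (rule sum_mono) (rule *)
    also have "\<dots> = (\<Sum>E\<in>?P. if E = K then t else 0) + card ?P"
      by (simp only: sum.distrib card_eq_sum)
    also have "\<dots> \<le> t + (card B choose 2)" using P by (simp add: sum.delta)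
    finally show ?thesis .
  qed
  moreover have "set xs \<subseteq> B" using xs(2) w(2) by blast
  moreover have "(\<Sum>E\<in>?P. length (w E)) = (card B choose 2) * t" using w(3) P by simp
  ultimately show ?thesis using xs P by (intro exI[of _ xs]) auto
qed

text \<open>
  For \<open>K = {x, y}\<close>, the blocks that contain \<open>x\<close> and those that contain \<open>y\<close> contribute at most
  one run each, hence at most \<open>2 * r\<close> in total; the exception is the at most one block that
  contains both, with the \<open>t + (k choose 2)\<close> runs of its word.
\<close>
lemma packing_word:
  assumes I: "finite I"
    and B: "\<And>i. i \<in> I \<Longrightarrow> B i \<subseteq> A \<and> finite (B i) \<and> card (B i) = k"
    and deg: "\<And>x. card {i \<in> I. x \<in> B i} \<le> r"
    and pair: "\<And>K. card K = 2 \<Longrightarrow> card {i \<in> I. K \<subseteq> B i} \<le> 1"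
    and s: "2 * r + t + (k choose 2) \<le> s + 1"
  shows "\<exists>xs. davenport_schinzel s A xs \<and>
    card I * ((k choose 2) * t) \<le> length xs + card I * ((k choose 2) + 1)"
proof -
  let ?C = "k choose 2"
  have "\<exists>xs. distinct_adj xs \<and> set xs \<subseteq> B i \<and> ?C * t \<le> length xs + ?C \<and>
    (\<forall>K. card K = 2 \<longrightarrow> runs K xs \<le> t + ?C)" if "i \<in> I" for i
    using block_word[of "B i" t] B[OF that] by auto
  then have "\<exists>w. \<forall>i\<in>I. distinct_adj (w i) \<and> set (w i) \<subseteq> B i \<and>
      ?C * t \<le> length (w i) + ?C \<and> (\<forall>K. card K = 2 \<longrightarrow> runs K (w i) \<le> t + ?C)"
    by (intro bchoice ballI)
  then obtain w where "\<forall>i\<in>I. distinct_adj (w i) \<and> set (w i) \<subseteq> B i \<and>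
      ?C * t \<le> length (w i) + ?C \<and> (\<forall>K. card K = 2 \<longrightarrow> runs K (w i) \<le> t + ?C)"
    by (rule exE)
  then have w: "\<And>i. i \<in> I \<Longrightarrow> distinct_adj (w i)" "\<And>i. i \<in> I \<Longrightarrow> set (w i) \<subseteq> B i"
    "\<And>i. i \<in> I \<Longrightarrow> ?C * t \<le> length (w i) + ?C"
    "\<And>i K. i \<in> I \<Longrightarrow> card K = 2 \<Longrightarrow> runs K (w i) \<le> t + ?C"
    by simp_all
  obtain xs where xs: "distinct_adj xs" "set xs = (\<Union>i\<in>I. set (w i))"
    "(\<Sum>i\<in>I. length (w i)) \<le> length xs + card I" "\<forall>K. runs K xs \<le> (\<Sum>i\<in>I. runs K (w i))"
    using glue_words[of I w, OF I w(1)] by blast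
  have "runs K xs \<le> s + 1" if K: "card K = 2" for K
  proof -
    obtain x y where xy: "K = {x, y}" "x \<noteq> y" using K by (auto simp: card_2_iff)
    have *: "runs K (w i) \<le> of_bool (x \<in> B i) + of_bool (y \<in> B i) + of_bool (K \<subseteq> B i) * (t + ?C)"
      if i: "i \<in> I" for i
    proof (cases "K \<subseteq> B i")
      case True
      then show ?thesis using w(4)[OF i K] by simp
    next
      case False
      have le: "card (set (w i) \<inter> K) \<le> card (B i \<inter> K)"
        using w(2)[OF i] B[OF i] by (intro card_mono) auto
      also have eq: "card (B i \<inter> K) = of_bool (x \<in> B i) + of_bool (y \<in> B i)"
        using xy False by auto
      also have "\<dots> \<le> 1" using False xy by auto
      finally have "runs K (w i) \<le> card (set (w i) \<inter> K)" by (rule runs_le_card)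
      then show ?thesis using le eq by simp
    qed
    have cnt: "(\<Sum>i\<in>I. of_bool (Q i)) = card {i \<in> I. Q i}" for Q
      using I by (simp add: of_bool_def sum.If_cases Int_def)
    have "runs K xs \<le> (\<Sum>i\<in>I. runs K (w i))" using xs by simp
    also have "\<dots> \<le> (\<Sum>i\<in>I. of_bool (x \<in> B i) + of_bool (y \<in> B i) + of_bool (K \<subseteq> B i) * (t + ?C))"
      by (rule sum_mono) (rule *)
    also have "\<dots> = card {i \<in> I. x \<in> B i} + card {i \<in> I. y \<in> B i} + card {i \<in> I. K \<subseteq> B i} * (t + ?C)"
      by (simp only: sum.distrib sum_distrib_right[symmetric] cnt)
    also have "\<dots> \<le> r + r + 1 * (t + ?C)"
      by (intro add_mono mult_mono deg pair[OF K]) auto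
    also have "\<dots> \<le> s + 1" using s by simp
    finally show ?thesis .
  qed
  moreover have "set xs \<subseteq> A" using xs(2) w(2) B by blast
  ultimately have "davenport_schinzel s A xs"
    using xs(1) by (simp add: davenport_schinzel_iff_runs)
  moreover have "card I * (?C * t) \<le> length xs + card I * (?C + 1)"
  proof -
    have "card I * (?C * t) = (\<Sum>i\<in>I. ?C * t)" by simp
    also have "\<dots> \<le> (\<Sum>i\<in>I. length (w i) + ?C)" by (rule sum_mono) (rule w(3))
    also have "\<dots> = (\<Sum>i\<in>I. length (w i)) + card I * ?C" by (simp add: sum.distrib)
    also have "\<dots> \<le> length xs + card I * (?C + 1)" using xs(3) by (simp add: algebra_simps)
    finally show ?thesis .
  qed
  ultimately show ?thesis by blast
qed

section \<open>Lines of a transversal design\<close>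

text \<open>
  The letter \<open>i * N + c\<close> with \<open>c < N\<close> stands for the entry \<open>c\<close> of column \<open>i\<close>, so that column and
  entry are recovered by \<open>div\<close> and \<open>mod\<close>. In these coordinates the lines are the graphs of the
  affine functions \<open>i \<mapsto> u + i * v\<close> from the columns to the residues modulo \<open>N\<close>.
\<close>
definition line :: "nat \<Rightarrow> nat \<Rightarrow> nat \<times> nat \<Rightarrow> nat set" where
  "line k N = (\<lambda>(u, v). (\<lambda>i. i * N + (u + i * v) mod N) ` {..<k})"

lemma mem_line_iff:
  assumes "N > 0"
  shows "x \<in> line k N (u, v) \<longleftrightarrow> x div N < k \<and> x mod N = (u + (x div N) * v) mod N"
proof
  assume "x \<in> line k N (u, v)"
  then obtain i where "i < k" "x = i * N + (u + i * v) mod N" by (auto simp: line_def)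
  then show "x div N < k \<and> x mod N = (u + (x div N) * v) mod N"
    using assms by simp
next
  assume *: "x div N < k \<and> x mod N = (u + (x div N) * v) mod N"
  then have "x = (x div N) * N + (u + (x div N) * v) mod N"
    by (metis div_mult_mod_eq)
  with * show "x \<in> line k N (u, v)" unfolding line_def by blast
qed

lemma line_in_columns:
  assumes "N > 0" "p \<in> {..<N} \<times> {..<N}"
  shows "line k N p \<subseteq> {..<k * N} \<and> finite (line k N p) \<and> card (line k N p) = k"
proof -
  obtain u v where p: "p = (u, v)" by (cases p)
  have "inj_on (\<lambda>i. i * N + (u + i * v) mod N) {..<k}"
  proof (rule inj_onI)
    fix i j assume "i * N + (u + i * v) mod N = j * N + (u + j * v) mod N"
    then have "(i * N + (u + i * v) mod N) div N = (j * N + (u + j * v) mod N) div N" by simp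
    then show "i = j" using assms(1) by simp
  qed
  then have "card (line k N p) = k" by (simp add: line_def p card_image)
  moreover have "line k N p \<subseteq> {..<k * N}"
    using mem_line_iff[OF assms(1)] by (auto simp: p less_mult_imp_div_less div_less_iff_less_mult assms(1))
  moreover have "finite (line k N p)" by (simp add: line_def p)
  ultimately show ?thesis by blast
qed

text \<open>
  A letter and a slope \<open>v\<close> determine the offset \<open>u\<close>.
\<close>
lemma card_lines_through_point:
  assumes "N > 0"
  shows "card {p \<in> {..<N} \<times> {..<N}. x \<in> line k N p} \<le> N"
proof -
  let ?S = "{p \<in> {..<N} \<times> {..<N}. x \<in> line k N p}"
  have "inj_on snd ?S"
  proof (rule inj_onI)
    fix p q assume pq: "p \<in> ?S" "q \<in> ?S" "snd p = snd q"
    obtain u v u' where p: "p = (u, v)" "q = (u', v)" using pq(3) by (metis prod.collapse)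
    have "[u + (x div N) * v = u' + (x div N) * v] (mod N)"
      using pq(1,2) unfolding p by (simp add: mem_line_iff[OF assms] cong_def)
    then have "[u = u'] (mod N)" by (simp add: cong_add_rcancel_nat)
    then have "u = u'" by (rule cong_less_modulus_unique_nat) (use pq p in auto)
    then show "p = q" using p by simp
  qed
  moreover have "snd ` ?S \<subseteq> {..<N}" by auto
  ultimately have "card ?S \<le> card {..<N}" by (intro card_inj_on_le[of snd]) auto
  then show ?thesis by simp
qed

text \<open>
  Two letters of the same column lie on no common line. For letters in distinct columns \<open>i\<close> and
  \<open>j\<close>, two common lines with slopes \<open>v\<close> and \<open>v'\<close> satisfy \<open>(i - j) * (v - v') \<equiv> 0\<close>
  modulo \<open>N\<close>, and \<open>\<bar>i - j\<bar> < k\<close> divides \<open>fact k\<close>, so it is invertible.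
\<close>
lemma card_lines_through_two_points:
  assumes N: "N > 0" "coprime N (fact k)" and K: "card K = 2"
  shows "card {p \<in> {..<N} \<times> {..<N}. K \<subseteq> line k N p} \<le> 1"
proof -
  let ?S = "{p \<in> {..<N} \<times> {..<N}. K \<subseteq> line k N p}"
  obtain x y where xy: "K = {x, y}" "x \<noteq> y" using K by (auto simp: card_2_iff)
  have "p = q" if p: "p \<in> ?S" and q: "q \<in> ?S" for p q
  proof -
    obtain u v u' v' where pq: "p = (u, v)" "q = (u', v')" by (metis prod.collapse)
    define i j where "i = x div N" and "j = y div N"
    have lt: "i < k" "j < k" "u < N" "v < N" "u' < N" "v' < N"
      using p q by (auto simp: pq xy mem_line_iff[OF N(1)] i_def j_def)
    have m: "x mod N = (u + i * v) mod N" "x mod N = (u' + i * v') mod N"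
      "y mod N = (u + j * v) mod N" "y mod N = (u' + j * v') mod N"
      using p q by (auto simp: pq xy mem_line_iff[OF N(1)] i_def j_def)
    have "i \<noteq> j"
      using xy(2) m div_mult_mod_eq[of x N] div_mult_mod_eq[of y N] by (auto simp: i_def j_def)
    have 1: "[int u + int i * int v = int u' + int i * int v'] (mod int N)"
      using m(1,2) unfolding cong_def by (metis of_nat_add of_nat_mod of_nat_mult)
    have 2: "[int u + int j * int v = int u' + int j * int v'] (mod int N)"
      using m(3,4) unfolding cong_def by (metis of_nat_add of_nat_mod of_nat_mult)
    have "int N dvd (int i - int j) * (int v - int v')"
      using dvd_diff[OF 1[unfolded cong_iff_dvd_diff] 2[unfolded cong_iff_dvd_diff]]
      by (simp add: algebra_simps)
    moreover have "coprime (int N) (int i - int j)"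
    proof -
      have "nat \<bar>int i - int j\<bar> dvd fact k"
        using lt \<open>i \<noteq> j\<close> by (intro dvd_fact) auto
      then have "coprime N (nat \<bar>int i - int j\<bar>)"
        using N(2) by (meson coprime_divisors dvd_refl)
      then show ?thesis by (metis coprime_abs_right_iff coprime_int_iff int_nat_eq abs_ge_zero)
    qed
    ultimately have "int N dvd int v - int v'" by (simp add: coprime_dvd_mult_right_iff)
    then have "[v = v'] (mod N)" by (simp add: cong_iff_dvd_diff flip: cong_int_iff)
    then have v: "v = v'" using lt(4,6) by (rule cong_less_modulus_unique_nat)
    then have "[u + i * v = u' + i * v] (mod N)" using m(1,2) unfolding cong_def by metis
    then have "[u = u'] (mod N)" by (simp add: cong_add_rcancel_nat)
    then have "u = u'" using lt(3,5) by (rule cong_less_modulus_unique_nat)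
    then show "p = q" using v pq by simp
  qed
  then show ?thesis by (intro card_le_Suc0_iff_eq[THEN iffD2, simplified One_nat_def[symmetric]]) auto
qed

text \<open>
  The alternations get the length \<open>t = s + 1 - 2 * N - (k choose 2)\<close>, the largest one that
  \<open>packing_word\<close> permits. If \<open>s\<close> is so small that no such \<open>t\<close> exists, the left-hand side is not
  positive.
\<close>
lemma ds_lambda_ge:
  assumes N: "N > 0" "coprime N (fact k)" "k * N \<le> m"
  shows "real N ^ 2 * (real (k choose 2) * (real s - 2 * real N - real (k choose 2)) - 1)
    \<le> real (ds_lambda s m)" (is "_ * (real ?C * ?t - 1) \<le> _")
proof (cases "2 * N + ?C \<le> s + 1")
  case True
  define t where "t = s + 1 - 2 * N - ?C"
  obtain xs where xs: "davenport_schinzel s {..<m} xs"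
    "card ({..<N} \<times> {..<N}) * (?C * t) \<le> length xs + card ({..<N} \<times> {..<N}) * (?C + 1)"
  proof -
    have "\<exists>xs. davenport_schinzel s {..<m} xs \<and>
    card ({..<N} \<times> {..<N}) * (?C * t) \<le> length xs + card ({..<N} \<times> {..<N}) * (?C + 1)"
    proof (rule packing_word[where r = N and B = "line k N"])
      show "line k N p \<subseteq> {..<m} \<and> finite (line k N p) \<and> card (line k N p) = k"
        if "p \<in> {..<N} \<times> {..<N}" for p
        using line_in_columns[OF N(1) that, of k] N(3) by fastforce
    qed (use N True card_lines_through_point card_lines_through_two_points in \<open>auto simp: t_def\<close>)
    then show ?thesis using that by blast
  qed
  then have "N\<^sup>2 * (?C * t) \<le> length xs + N\<^sup>2 * (?C + 1)"
    by (simp add: power2_eq_square)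
  also have "\<dots> \<le> ds_lambda s m + N\<^sup>2 * (?C + 1)" using length_le_ds_lambda[OF xs(1)] by simp
  finally have "real (N\<^sup>2 * (?C * t)) \<le> real (ds_lambda s m + N\<^sup>2 * (?C + 1))"
    by (simp only: of_nat_le_iff)
  moreover have "real t = ?t + 1" using True by (simp add: t_def of_nat_diff)
  ultimately show ?thesis by (simp add: algebra_simps)
next
  case False
  then have "real s + 1 < 2 * real N + real ?C" by linarith
  then have "real ?C * ?t \<le> 0" by (intro mult_nonneg_nonpos) auto
  then have "real N ^ 2 * (real ?C * ?t - 1) \<le> 0" by (intro mult_nonneg_nonpos) auto
  then show ?thesis by (rule order_trans) simp
qed

section \<open>Asymptotics\<close>

lemma real_choose_two: "real (n choose 2) = real n * (real n - 1) / 2"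
  by (induction n) (auto simp: numeral_2_eq_2 field_simps)

text \<open>
  Take the largest number of the form \<open>fact k * q + 1\<close> that is at most \<open>m div k\<close>.
\<close>
lemma exists_modulus_coprime_fact:
  assumes "k > 0" "k \<le> m"
  shows "\<exists>N>0. coprime N (fact k) \<and> k * N \<le> m \<and> real m / real k - fact k \<le> real N"
proof -
  define d where "d = m div k"
  define N where "N = fact k * ((d - 1) div fact k) + 1"
  have d: "d \<ge> 1" "k * d \<le> m" "m < k * (d + 1)"
    using assms by (auto simp: d_def div_greater_zero_iff Suc_le_eq dividend_less_times_div)
  have "N \<le> d" using d(1) unfolding N_def
    by (metis Nat.le_diff_conv2 mult.commute div_times_less_eq_dividend)
  then have "k * N \<le> m" using d(2) by (meson le_trans mult_le_mono2)
  moreover have "coprime N (fact k)"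
  proof (rule coprimeI)
    fix e assume "e dvd N" "e dvd fact k"
    then have "e dvd fact k * ((d - 1) div fact k)" by (intro dvd_mult2)
    with \<open>e dvd N\<close> show "is_unit e"
      unfolding N_def using dvd_add_right_iff by blast
  qed
  moreover have "real m / real k - fact k \<le> real N"
  proof -
    have "d - 1 < fact k * ((d - 1) div fact k) + fact k"
      by (metis dividend_less_times_div fact_gt_zero add.commute)
    then have "d + 1 \<le> N + fact k" unfolding N_def using d(1) by linarith
    then have "real (d + 1) \<le> real (N + fact k)" by (simp only: of_nat_le_iff)
    moreover have "real m < real k * real (d + 1)"
      using d(3) by (metis of_nat_less_iff of_nat_mult)
    then have "real m / real k < real (d + 1)"
      using assms(1) by (simp add: field_simps)
    ultimately show ?thesis by simp
  qed
  ultimately show ?thesis by (intro exI[of _ N]) (simp add: N_def)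
qed

text \<open>
  For fixed \<open>k\<close>, the bound of \<open>ds_lambda_ge\<close> with \<open>s \<approx> a * n\<close>, \<open>m \<approx> b * n\<close> and
  \<open>N \<approx> b * n / k\<close> is a cubic in \<open>n\<close> with leading coefficient
  \<open>(b / k)\<^sup>2 * (k choose 2) * (a - 2 * b / k)\<close>. The positivity of the last factor allows \<open>N\<close> to be
  replaced by its lower bound in the factor \<open>N\<^sup>2\<close>.
\<close>
lemma eventually_ds_lambda_gt:
  fixes a b :: real and k :: nat
  assumes "a > 0" "b > 0" "k \<ge> 2" "a - 2 * b / k > 0"
    and l: "l < (1 - 1 / k) * (a - 2 * b / k) * b\<^sup>2 / 2"
  shows "\<forall>\<^sub>F n in at_top.
    l < real (ds_lambda (nat \<lfloor>a * real n\<rfloor>) (nat \<lfloor>b * real n\<rfloor>)) / real n ^ 3"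
proof -
  define C where "C = real (k choose 2)"
  \<comment> \<open>The distance of \<open>N\<close> from \<open>b * n / k\<close>: \<open>fact k\<close> from the choice of \<open>N\<close>, and \<open>1 / k \<le> 1\<close> from
    rounding \<open>b * n\<close> down to \<open>m\<close>.\<close>
  define c :: real where "c = fact k + 1"
  define \<beta> where "\<beta> = b / k"
  define \<delta> where "\<delta> = a - 2 * \<beta>"
  define g where "g n = (\<beta> * real n - c)\<^sup>2 * (C * (\<delta> * real n - (1 + C)) - 1)" for n :: nat
  have C: "C = k * (k - 1) / 2" "C > 0"
    using assms(3) by (simp_all add: C_def real_choose_two of_nat_diff)
  have pos: "\<beta> > 0" "\<delta> > 0" using assms by (auto simp: \<beta>_def \<delta>_def)
  have "\<beta>\<^sup>2 * C * \<delta> = (1 - 1 / k) * (a - 2 * b / k) * b\<^sup>2 / 2"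
    using assms(3) by (simp add: C(1) \<beta>_def \<delta>_def field_simps power2_eq_square of_nat_diff)
  moreover have "((\<lambda>n. g n / real n ^ 3) \<longlongrightarrow> \<beta>\<^sup>2 * C * \<delta>) at_top"
    using pos C(2) unfolding g_def by real_asymp
  ultimately have "\<forall>\<^sub>F n in at_top. l < g n / real n ^ 3"
    using l by (metis order_tendstoD(1))
  moreover have "\<forall>\<^sub>F n::nat in at_top. \<beta> * real n - c > 0" "\<forall>\<^sub>F n::nat in at_top. b * real n - 1 - k > 0"
    using pos assms(2) by real_asymp+
  moreover have "\<forall>\<^sub>F n::nat in at_top. C * (\<delta> * real n - (1 + C)) - 1 > 0"
    using pos C(2) by real_asymp
  ultimately show ?thesis
  proof eventually_elim
    case (elim n)
    define s m where "s = nat \<lfloor>a * real n\<rfloor>" and "m = nat \<lfloor>b * real n\<rfloor>"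
    have sm: "a * n - 1 \<le> real s" "b * n - 1 \<le> real m" "real m \<le> b * n"
      using assms(1,2) by (auto simp: s_def m_def)
    then have "real k \<le> real m" using elim(3) by linarith
    then have "k \<le> m" by simp
    then obtain N where N: "N > 0" "coprime N (fact k)" "k * N \<le> m" "real m / k - fact k \<le> real N"
      using exists_modulus_coprime_fact[of k m] assms(3) by auto
    have "\<beta> * n - c \<le> real m / k - fact k"
    proof -
      have "\<beta> * n - 1 / k = (b * n - 1) / k" by (simp add: \<beta>_def diff_divide_distrib)
      also have "\<dots> \<le> real m / k" using sm(2) by (intro divide_right_mono) auto
      finally have "\<beta> * n - 1 / k \<le> real m / k" .
      moreover have "1 / real k \<le> 1" using assms(3) by simp
      ultimately show ?thesis by (simp add: c_def)
    qed
    then have lo: "\<beta> * n - c \<le> N" using N(4) by linarith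
    have "real k * real N \<le> b * n"
      using N(3) sm(3) by (metis of_nat_le_iff of_nat_mult order_trans)
    then have "real N \<le> \<beta> * n" using assms(3) by (simp add: \<beta>_def field_simps)
    then have "\<delta> * n - (1 + C) \<le> real s - 2 * real N - C"
      using sm(1) by (simp add: \<delta>_def algebra_simps)
    then have "C * (\<delta> * n - (1 + C)) \<le> C * (real s - 2 * real N - C)"
      using C(2) by (intro mult_left_mono) auto
    then have "g n \<le> (real N)\<^sup>2 * (C * (real s - 2 * real N - C) - 1)"
      unfolding g_def using lo elim by (intro mult_mono power_mono) auto
    also have "\<dots> \<le> real (ds_lambda s m)"
      using ds_lambda_ge[OF N(1-3)] by (simp add: C_def)
    finally have "g n / real n ^ 3 \<le> real (ds_lambda s m) / real n ^ 3"
      by (intro divide_right_mono) auto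
    with elim(1) show ?case unfolding s_def m_def by linarith
  qed
qed

lemma ds_lambda_floor_le:
  fixes a b :: real
  assumes "a > 0" "b > 0"
  shows "real (ds_lambda (nat \<lfloor>a * real n\<rfloor>) (nat \<lfloor>b * real n\<rfloor>)) \<le> 1 + a * b\<^sup>2 / 2 * real n ^ 3"
proof -
  define s m where "s = nat \<lfloor>a * real n\<rfloor>" and "m = nat \<lfloor>b * real n\<rfloor>"
  have sm: "real s \<le> a * n" "real m \<le> b * n" using assms by (auto simp: s_def m_def)
  have "real (ds_lambda s m) \<le> real (1 + (m choose 2) * s)"
    using ds_lambda_le[of s m] by (simp only: of_nat_le_iff)
  also have "\<dots> = 1 + real m * (real m - 1) / 2 * real s" by (simp add: real_choose_two)
  also have "\<dots> \<le> 1 + real m * real m / 2 * real s"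
    by (intro add_mono mult_right_mono divide_right_mono mult_left_mono) auto
  also have "\<dots> \<le> 1 + (b * n) * (b * n) / 2 * (a * n)"
    using sm assms by (intro add_mono mult_mono divide_right_mono) auto
  also have "\<dots> = 1 + a * b\<^sup>2 / 2 * real n ^ 3" by (simp add: power2_eq_square power3_eq_cube)
  finally show ?thesis by (simp add: s_def m_def)
qed

theorem corollary6:
  fixes a b :: real
  assumes "a > 0" and "b > 0"
  shows "(\<lambda>n::nat. real (ds_lambda (nat \<lfloor>a * real n\<rfloor>) (nat \<lfloor>b * real n\<rfloor>)))
           \<sim>[at_top] (\<lambda>n. a * b ^ 2 / 2 * real n ^ 3)"
proof -
  define L where "L = a * b\<^sup>2 / 2"
  define f where "f n = real (ds_lambda (nat \<lfloor>a * real n\<rfloor>) (nat \<lfloor>b * real n\<rfloor>))" for n :: nat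
  have "L > 0" using assms by (simp add: L_def)
  have "((\<lambda>n. f n / real n ^ 3) \<longlongrightarrow> L) at_top"
  proof (rule order_tendstoI)
    fix l assume "l < L"
    have "((\<lambda>k::nat. (1 - 1 / k) * (a - 2 * b / k) * b\<^sup>2 / 2) \<longlongrightarrow> a * b\<^sup>2 / 2) at_top"
      by real_asymp
    then have "\<forall>\<^sub>F k::nat in at_top. l < (1 - 1 / k) * (a - 2 * b / k) * b\<^sup>2 / 2"
      using \<open>l < L\<close> by (intro order_tendstoD(1)) (auto simp: L_def)
    moreover have "\<forall>\<^sub>F k::nat in at_top. a - 2 * b / k > 0"
      using assms by real_asymp
    moreover have "\<forall>\<^sub>F k::nat in at_top. k \<ge> (2::nat)"
      by (rule eventually_ge_at_top)
    ultimately have "\<forall>\<^sub>F k::nat in at_top. l < (1 - 1 / k) * (a - 2 * b / k) * b\<^sup>2 / 2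
        \<and> a - 2 * b / k > 0 \<and> k \<ge> (2::nat)"
      by eventually_elim simp
    then obtain k :: nat where k: "l < (1 - 1 / k) * (a - 2 * b / k) * b\<^sup>2 / 2"
        "a - 2 * b / k > 0" "k \<ge> (2::nat)"
      by (auto dest!: eventually_happens'[OF sequentially_bot])
    show "\<forall>\<^sub>F n in at_top. l < f n / real n ^ 3"
      unfolding f_def by (rule eventually_ds_lambda_gt[OF assms k(3,2,1)])
  next
    fix u assume "L < u"
    have "((\<lambda>n::nat. 1 / real n ^ 3 + L) \<longlongrightarrow> L) at_top" by real_asymp
    then have "\<forall>\<^sub>F n::nat in at_top. 1 / real n ^ 3 + L < u"
      using \<open>L < u\<close> by (rule order_tendstoD(2))
    then show "\<forall>\<^sub>F n in at_top. f n / real n ^ 3 < u"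
      using eventually_gt_at_top[of 0]
    proof eventually_elim
      case (elim n)
      have "f n / real n ^ 3 \<le> (1 + L * real n ^ 3) / real n ^ 3"
        using ds_lambda_floor_le[OF assms, of n] unfolding f_def L_def
        by (intro divide_right_mono) auto
      also have "\<dots> = 1 / real n ^ 3 + L" using elim(2) by (simp add: add_divide_distrib)
      finally show ?case using elim(1) by linarith
    qed
  qed
  then have "f \<sim>[at_top] (\<lambda>n. L * real n ^ 3)"
    using \<open>L > 0\<close> by (intro asymp_equivI'_const) auto
  then show ?thesis unfolding f_def[abs_def] L_def .
qed

end
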